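(* Let $\epsilon,\delta\in[0,1)$ and assume that there exist constants $0<c_{1}\leq c_{2}$ and $c_{3}>0$ such that $c_{1}\leq q_{k}(v_{k,\epsilon})\leq c_{2}$, $q_{k}(\tilde{u}_{k,\epsilon})\geq c_{1}$ and $P_{k}\succeq c_{3}I_{n}$ for all $k$. Then the $(\epsilon,\delta)$-approximate subspace descent direction $d_{S}^{k,\epsilon,\delta}$ satisfies, for all $i\in[m]$, $$\left\langle\nabla f_{i}(x^{k}),\tfrac12 d_{S}^{k,\epsilon,\delta}\right\rangle+g_{i}\left(Ax^{k}+\tfrac12 Ad_{S}^{k,\epsilon,\delta}\right)-g_{i}(Ax^k)\leq-\frac{c_{1}(1-\delta)\alpha^{k}_{i}}{4}\left\|d_{S}^{k,\epsilon,\delta}\right\|^{2},$$ and $$\begin{aligned}&\left\langle\nabla f_{i}(x^{k}),\tfrac12 d_{S}^{k,\epsilon,\delta}\right\rangle+g_{i}\left(Ax^{k}+\tfrac12 Ad_{S}^{k,\epsilon,\delta}\right)-g_{i}(Ax^k)\\&\quad\leq c\,\alpha^{k}_{i}\left(\left\langle\nabla f_{\lambda_{PBB}^{k,\epsilon}/\tilde{\alpha}^{k}}(x^{k}),v_{k,\epsilon}\right\rangle+g_{\lambda_{PBB}^{k,\epsilon}/\tilde{\alpha}^{k}}(Ax^{k}+Av_{k,\epsilon})-g_{\lambda_{PBB}^{k,\epsilon}/\tilde{\alpha}^{k}}(Ax^k)\right),\end{aligned}$$ where $$c:=\frac{(1-\delta)(1-\epsilon)\alpha_{\min}}{4\alp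ha_{\max}}\min\left\{\frac{(1-\epsilon)c_{3}\alpha_{\min}}{c_{2}\alpha_{\max}},1\right\}.$$
   Context: Problem: minimize $F^A(x)=(f_1(x)+g_1(Ax),\dots,f_m(x)+g_m(Ax))$ over $x\in\mathbb{R}^n$, where $A\in\mathbb{R}^{p\times n}$, $f_i:\mathbb{R}^n\to\mathbb{R}$ is continuously differentiable and $g_i:\mathbb{R}^p\to\mathbb{R}\cup\{+\infty\}$ is proper, convex, lower semicontinuous. $[m]=\{1,\dots,m\}$, $\Delta_m$ is the unit simplex in $\mathbb{R}^m$. For $w\in\mathbb{R}^m_+$: $f_w=\sum w_if_i$, $g_w=\sum w_ig_i$ (equal to $+\infty$ where some $g_i$ is), $\nabla f_w=\sum w_i\nabla f_i$; $\lambda/\alpha$ is componentwise division; $\|x\|_P=\sqrt{\langle x,Px\rangle}$; $U\succeq V$ means $U-V$ is positive semidefinite. $Jf(x)$ is the Jacobian of $f=(f_1,\dots,f_m)$, $g=(g_1,\dots,g_m)$. Data at iteration $k$: the current point $x^k$ satisfies $Ax^k\in\bigcap_i\mathrm{dom}(g_i)$; $P_k$ is symmetric positive definite; $\tilde\alpha^k,\alpha^k$ are scaling vectors, obtained by (Barzilai--Borwein) formulas truncated so that $\tilde\alpha^k_i,\alpha_i^k\in[\alpha_{\min},\alpha_{\max}]$ for all $i$, with constants $0<\alpha_{\min}\le\alpha_{\max}$. First approximate direction. For $\lambda\in\Delta_m$ let $x(\lambda)$ be the minimizer over $x\in\mathbb{R}^n$ of $\langle\nabla f_{\lambda/\tilde\alpha^k}(x^k),x-x^k\rangle+g_{\lambda/\tilde\alpha^k}(Ax)-g_{\lambda/\tilde\alpha^k}(Ax^k)+\frac12\|x-x^k\|_{P_k}^2$,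 and $$\mathcal{D}^k_{PBB}(\lambda):=\max_{i\in[m]}\frac{\langle\nabla f_i(x^k),x(\lambda)-x^k\rangle+g_i(Ax(\lambda))-g_i(Ax^k)}{\tilde\alpha_i^k}.$$ $\lambda^{k,\epsilon}_{PBB}\in\Delta_m$ and $v_{k,\epsilon}:=x(\lambda^{k,\epsilon}_{PBB})-x^k$ (assumed nonzero) are such that $$\mathcal{D}^k_{PBB}(\lambda^{k,\epsilon}_{PBB})\le(1-\epsilon)\left(\langle\nabla f_{\lambda^{k,\epsilon}_{PBB}/\tilde\alpha^k}(x^k),v_{k,\epsilon}\rangle+g_{\lambda^{k,\epsilon}_{PBB}/\tilde\alpha^k}(Ax^k+Av_{k,\epsilon})-g_{\lambda^{k,\epsilon}_{PBB}/\tilde\alpha^k}(Ax^k)\right).$$ Subspace. $\tilde u_{k,\epsilon}:=u_k-\frac{\langle u_k,B_kv_{k,\epsilon}\rangle}{\langle v_{k,\epsilon},B_kv_{k,\epsilon}\rangle}v_{k,\epsilon}$, where $B_k$ is a symmetric positive definite matrix and $u_k$ is the projection, in the norm $\|\cdot\|_{P_k}$, of $x^k+(x^k-x^{k-1})$ onto $\bigcap_i\mathrm{dom}(g_i\circ A)$, minus $x^k$. The real numbers $q_k(v_{k,\epsilon}),q_k(\tilde u_{k,\epsilon})>0$ are approximations of $\langle v,B_kv\rangle/\|v\|^2$ for $v=v_{k,\epsilon},\tilde u_{k,\epsilon}$. For $\lambda\in\Delta_m$, $z_1(\lambda)$ and $z_2(\lambda)$ are minimizers, respectively, of $$\min_{z_1\in\mathbb{R}}\left\langle\tfrac{\lambda}{\alpha^k},z_1Jf(x^k)v_{k,\epsilon}+g(Ax^k+z_1Av_{k,\epsilon})\right\rangle+\tfrac{q_k(v_{k,\epsilon})}{2}\|v_{k,\epsilon}\|^2z_1^2,$$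 $$\min_{z_2\in\mathbb{R}}\left\langle\tfrac{\lambda}{\alpha^k},z_2Jf(x^k)\tilde u_{k,\epsilon}+g(Ax^k+z_2A\tilde u_{k,\epsilon})\right\rangle+\tfrac{q_k(\tilde u_{k,\epsilon})}{2}\|\tilde u_{k,\epsilon}\|^2z_2^2,$$ and $$\mathcal{D}^k(\lambda):=\max_{i\in[m]}\frac{\langle\nabla f_i(x^k),z_1(\lambda)v_{k,\epsilon}+z_2(\lambda)\tilde u_{k,\epsilon}\rangle+g_i(Ax^k+z_1(\lambda)Av_{k,\epsilon})+g_i(Ax^k+z_2(\lambda)A\tilde u_{k,\epsilon})-2g_i(Ax^k)}{\alpha_i^k}.$$ $(\epsilon,\delta)$-approximate subspace descent direction: $d_S^{k,\epsilon,\delta}:=z_1(\lambda^{k,\epsilon,\delta})v_{k,\epsilon}+z_2(\lambda^{k,\epsilon,\delta})\tilde u_{k,\epsilon}$, where $\lambda^{k,\epsilon,\delta}\in\Delta_m$ satisfies, with $w:=\lambda^{k,\epsilon,\delta}/\alpha^k$, $$\mathcal{D}^k(\lambda^{k,\epsilon,\delta})\le(1-\delta)\left(\langle\nabla f_w(x^k),d_S^{k,\epsilon,\delta}\rangle+g_w(Ax^k+z_1(\lambda^{k,\epsilon,\delta})Av_{k,\epsilon})+g_w(Ax^k+z_2(\lambda^{k,\epsilon,\delta})A\tilde u_{k,\epsilon})-2g_w(Ax^k)\right).$$ *)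

theory Defs
  imports "HOL-Analysis.Analysis"
begin

subsection \<open>Differentiable functions\<close>

definition gradient :: "('a::real_inner \<Rightarrow> real) \<Rightarrow> 'a \<Rightarrow> 'a" where
  "gradient h x = (THE d. GDERIV h x :> d)"

definition continuously_differentiable :: "('a::real_inner \<Rightarrow> real) \<Rightarrow> bool" where
  "continuously_differentiable h \<longleftrightarrow>
     (\<forall>x. h differentiable (at x)) \<and> continuous_on UNIV (gradient h)"

subsection \<open>Extended-real-valued functions\<close>

definition edom :: "('a \<Rightarrow> ereal) \<Rightarrow> 'a set" where
  "edom h = {y. h y < \<infinity>}"

definition proper_fun :: "('a \<Rightarrow> ereal) \<Rightarrow> bool" where
  "proper_fun h \<longleftrightarrow> (\<forall>y. h y \<noteq> -\<infinity>) \<and> edom h \<noteq> {}"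

text \<open>Used for functions that never take the value \<open>-\<infinity>\<close>, so the right-hand side is
  never of the form \<open>\<infinity> + -\<infinity>\<close>. The library convention \<open>0 * \<infinity> = 0\<close> makes the cases
  \<open>t = 0\<close> and \<open>t = 1\<close> trivially true.\<close>

definition convex_fun :: "('a::real_vector \<Rightarrow> ereal) \<Rightarrow> bool" where
  "convex_fun h \<longleftrightarrow>
     (\<forall>x y. \<forall>t\<in>{0..1}. h ((1 - t) *\<^sub>R x + t *\<^sub>R y) \<le> ereal (1 - t) * h x + ereal t * h y)"

definition lsc_fun :: "('a::topological_space \<Rightarrow> ereal) \<Rightarrow> bool" where
  "lsc_fun h \<longleftrightarrow> (\<forall>x. h x \<le> Liminf (at x) h)"

subsection \<open>Matrices\<close>

definition sym_pos_def :: "real^'n^'n \<Rightarrow> bool" where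
  "sym_pos_def M \<longleftrightarrow> transpose M = M \<and> (\<forall>x. x \<noteq> 0 \<longrightarrow> 0 < x \<bullet> (M *v x))"

definition sym_pos_semidef :: "real^'n^'n \<Rightarrow> bool" where
  "sym_pos_semidef M \<longleftrightarrow> transpose M = M \<and> (\<forall>x. 0 \<le> x \<bullet> (M *v x))"

definition loewner_ge :: "real^'n^'n \<Rightarrow> real^'n^'n \<Rightarrow> bool" where
  "loewner_ge U V \<longleftrightarrow> sym_pos_semidef (U - V)"

definition mat_norm :: "real^'n^'n \<Rightarrow> real^'n \<Rightarrow> real" where
  "mat_norm M x = sqrt (x \<bullet> (M *v x))"

subsection \<open>Weights and scalarisation\<close>

definition unit_simplex :: "(real^'m) set" where
  "unit_simplex = {l. (\<forall>i. 0 \<le> l $ i) \<and> (\<Sum>i\<in>UNIV. l $ i) = 1}"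

definition cdiv :: "real^'m \<Rightarrow> real^'m \<Rightarrow> real^'m" where
  "cdiv l a = (\<chi> i. l $ i / a $ i)"

text \<open>The inner product of a nonnegative weight vector with an extended-real vector.
  It is \<open>\<infinity>\<close> as soon as one entry is, even if the weight of that entry is \<open>0\<close>;
  the bare sum would use \<open>0 * \<infinity> = 0\<close> instead.\<close>

definition winner :: "real^'m \<Rightarrow> ('m \<Rightarrow> ereal) \<Rightarrow> ereal" where
  "winner w h = (if \<exists>i. h i = \<infinity> then \<infinity> else (\<Sum>i\<in>UNIV. ereal (w $ i) * h i))"

definition gw :: "('m::finite \<Rightarrow> 'b \<Rightarrow> ereal) \<Rightarrow> real^'m \<Rightarrow> 'b \<Rightarrow> ereal" where
  "gw g w y = winner w (\<lambda>i. g i y)"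

definition gradw :: "('m::finite \<Rightarrow> 'a::real_inner \<Rightarrow> real) \<Rightarrow> real^'m \<Rightarrow> 'a \<Rightarrow> 'a" where
  "gradw f w x = (\<Sum>i\<in>UNIV. (w $ i) *\<^sub>R gradient (f i) x)"

subsection \<open>The first direction\<close>

definition pbb_objective ::
  "('m::finite \<Rightarrow> real^'n \<Rightarrow> real) \<Rightarrow> ('m \<Rightarrow> real^'p \<Rightarrow> ereal) \<Rightarrow> real^'n^'p \<Rightarrow> real^'n^'n
   \<Rightarrow> real^'m \<Rightarrow> real^'n \<Rightarrow> real^'m \<Rightarrow> real^'n \<Rightarrow> ereal" where
  "pbb_objective f g A P sc xk l x =
     ereal (gradw f (cdiv l sc) xk \<bullet> (x - xk))
     + gw g (cdiv l sc) (A *v x) - gw g (cdiv l sc) (A *v xk)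
     + ereal (1 / 2 * (mat_norm P (x - xk))\<^sup>2)"

text \<open>\<open>X\<close> is the solution map \<open>l \<mapsto> x(l)\<close>.\<close>

definition D_PBB ::
  "('m::finite \<Rightarrow> real^'n \<Rightarrow> real) \<Rightarrow> ('m \<Rightarrow> real^'p \<Rightarrow> ereal) \<Rightarrow> real^'n^'p
   \<Rightarrow> real^'m \<Rightarrow> real^'n \<Rightarrow> (real^'m \<Rightarrow> real^'n) \<Rightarrow> real^'m \<Rightarrow> ereal" where
  "D_PBB f g A sc xk X l =
     (MAX i. (ereal (gradient (f i) xk \<bullet> (X l - xk)) + g i (A *v X l) - g i (A *v xk))
             / ereal (sc $ i))"

subsection \<open>The subspace direction\<close>

text \<open>The iterate preceding \<open>x k\<close>, where \<open>x0\<close> plays the role of \<open>x\<close> at index \<open>-1\<close>.\<close>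

definition prev :: "'a \<Rightarrow> (nat \<Rightarrow> 'a) \<Rightarrow> nat \<Rightarrow> 'a" where
  "prev x0 x k = (case k of 0 \<Rightarrow> x0 | Suc j \<Rightarrow> x j)"

definition is_projection :: "real^'n^'n \<Rightarrow> (real^'n) set \<Rightarrow> real^'n \<Rightarrow> real^'n \<Rightarrow> bool" where
  "is_projection P S y p \<longleftrightarrow> is_arg_min (\<lambda>s. mat_norm P (s - y)) (\<lambda>s. s \<in> S) p"

definition B_orth :: "real^'n^'n \<Rightarrow> real^'n \<Rightarrow> real^'n \<Rightarrow> real^'n" where
  "B_orth B v u = u - ((u \<bullet> (B *v v)) / (v \<bullet> (B *v v))) *\<^sub>R v"

text \<open>The one-dimensional problem along \<open>v\<close> with curvature \<open>q\<close>, as a function of the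
  step \<open>z\<close>; it is used both for the first direction and for its companion.\<close>

definition line_objective ::
  "('m::finite \<Rightarrow> real^'n \<Rightarrow> real) \<Rightarrow> ('m \<Rightarrow> real^'p \<Rightarrow> ereal) \<Rightarrow> real^'n^'p
   \<Rightarrow> real^'m \<Rightarrow> real^'n \<Rightarrow> real^'n \<Rightarrow> real \<Rightarrow> real^'m \<Rightarrow> real \<Rightarrow> ereal" where
  "line_objective f g A al xk v q l z =
     winner (cdiv l al)
       (\<lambda>i. ereal ((z *\<^sub>R (jacobian (\<lambda>x. \<chi> j. f j x) (at xk) *v v)) $ i)
            + g i (A *v xk + z *\<^sub>R (A *v v)))
     + ereal (q / 2 * (norm v)\<^sup>2 * z\<^sup>2)"

definition D_sub ::
  "('m::finite \<Rightarrow> real^'n \<Rightarrow> real) \<Rightarrow> ('m \<Rightarrow> real^'p \<Rightarrow> ereal) \<Rightarrow> real^'n^'p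
   \<Rightarrow> real^'m \<Rightarrow> real^'n \<Rightarrow> real^'n \<Rightarrow> real^'n \<Rightarrow> (real^'m \<Rightarrow> real) \<Rightarrow> (real^'m \<Rightarrow> real)
   \<Rightarrow> real^'m \<Rightarrow> ereal" where
  "D_sub f g A al xk v u z1 z2 l =
     (MAX i. (ereal (gradient (f i) xk \<bullet> (z1 l *\<^sub>R v + z2 l *\<^sub>R u))
              + g i (A *v xk + z1 l *\<^sub>R (A *v v))
              + g i (A *v xk + z2 l *\<^sub>R (A *v u))
              - 2 * g i (A *v xk))
             / ereal (al $ i))"

end

theory Submission
  imports Defs
begin

text \<open>Call the \<^emph>\<open>increment\<close> of objective \<open>i\<close> along a step \<open>s\<close> the number
  \<open>\<langle>\<nabla>f\<^sub>i(x), s\<rangle> + g\<^sub>i(Ax + As) - g\<^sub>i(Ax)\<close>. It is convex in \<open>s\<close> and vanishes at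
  \<open>s = 0\<close>, and so does every nonnegatively weighted sum \<open>\<phi>\<close> of increments. Each of
  the three subproblems minimizes such a \<open>\<phi>\<close> plus a quadratic term. Shrinking a minimizer
  \<open>s\<close> to \<open>t s\<close> replaces \<open>\<phi>(s)\<close> by at most \<open>t \<phi>(s)\<close> and the quadratic
  \<open>Q/2\<close> by \<open>t\<^sup>2 Q/2\<close>; letting \<open>t\<close> tend to 1 gives \<open>\<phi>(s) \<le> -Q\<close>, that is,
  decrease by twice the quadratic term at the solution. This is
  \<open>scaling_minimizer_wincr_le\<close>.

  Let \<open>s\<^sub>1 = z\<^sub>1 v\<close> and \<open>s\<^sub>2 = z\<^sub>2 u\<close> be the two line steps, so that \<open>d = s\<^sub>1 + s\<^sub>2\<close>.
  Convexity bounds the increment along \<open>d/2\<close>, the midpoint of \<open>s\<^sub>1\<close> and \<open>s\<^sub>2\<close>, by the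
  average of the increments along them. Let \<open>\<phi>\<close> now carry the weights of the line problems;
  the approximate optimality condition bounds that average, for every \<open>i\<close>, by \<open>(1 - \<delta>) \<alpha>\<^sub>i/2\<close> times \<open>\<phi>(s\<^sub>1) + \<phi>(s\<^sub>2)\<close>. As
  \<open>\<phi>(s\<^sub>j) \<le> -c\<^sub>1 \<parallel>s\<^sub>j\<parallel>\<^sup>2\<close> and \<open>\<parallel>d\<parallel>\<^sup>2 \<le> 2 \<parallel>s\<^sub>1\<parallel>\<^sup>2 + 2 \<parallel>s\<^sub>2\<parallel>\<^sup>2\<close>, the first
  estimate follows.

  For the second one, \<open>\<phi>(s\<^sub>2) \<le> 0\<close> may be dropped, and \<open>\<phi>(s\<^sub>1)\<close> has to be compared with the
  predicted decrease \<open>\<theta> < 0\<close> of the first subproblem. The step \<open>v\<close> itself lies on the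
  first line, and the condition defining it gives
  \<open>\<phi>(v) \<le> r \<theta>\<close> with \<open>r = (1 - \<epsilon>) \<alpha>min/\<alpha>max\<close>. Moreover
  \<open>\<theta> \<le> -\<parallel>v\<parallel>\<^sub>P\<^sup>2 \<le> -c\<^sub>3 \<parallel>v\<parallel>\<^sup>2\<close>, which converts the quadratic term along the line into a
  multiple of \<open>\<theta>\<close>. Comparing the minimizer with the step \<open>t v\<close>, where
  \<open>t = min (r c\<^sub>3/c\<^sub>2) 1\<close>, then gives \<open>\<phi>(s\<^sub>1) \<le> r t \<theta>/2\<close> (\<open>best_step_le\<close>).\<close>

section \<open>Gradients and positive definite matrices\<close>

lemma GDERIV_gradient:
  fixes h :: "'a::euclidean_space \<Rightarrow> real"
  assumes "h differentiable (at x)"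
  shows "GDERIV h x :> gradient h x"
proof -
  obtain h' where h': "(h has_derivative h') (at x)"
    using assms by (auto simp: differentiable_def)
  then interpret bounded_linear h'
    by (rule has_derivative_bounded_linear)
  have "h' = (\<lambda>s. s \<bullet> (\<Sum>b\<in>Basis. h' b *\<^sub>R b))"
  proof
    fix s
    have "h' s = h' (\<Sum>b\<in>Basis. (s \<bullet> b) *\<^sub>R b)"
      by (simp add: euclidean_representation)
    then show "h' s = s \<bullet> (\<Sum>b\<in>Basis. h' b *\<^sub>R b)"
      by (simp add: sum scaleR inner_sum_right mult.commute)
  qed
  with h' have D: "GDERIV h x :> (\<Sum>b\<in>Basis. h' b *\<^sub>R b)"
    by (simp add: gderiv_def)
  show ?thesis
    unfolding gradient_def
  proof (rule theI[where P = "\<lambda>d. GDERIV h x :> d", OF D])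
    fix d
    assume "GDERIV h x :> d"
    then have "(\<lambda>s. s \<bullet> d) = (\<lambda>s. s \<bullet> (\<Sum>b\<in>Basis. h' b *\<^sub>R b))"
      using D unfolding gderiv_def by (rule has_derivative_unique)
    then show "d = (\<Sum>b\<in>Basis. h' b *\<^sub>R b)"
      by (metis vector_eq_ldot)
  qed
qed

lemma jacobian_mult_component:
  fixes f :: "'m::finite \<Rightarrow> real^'n \<Rightarrow> real"
  assumes "\<And>i. f i differentiable (at x)"
  shows "(jacobian (\<lambda>y. \<chi> j. f j y) (at x) *v s) $ i = gradient (f i) x \<bullet> s"
proof -
  let ?F = "\<lambda>y. \<chi> j. f j y"
  have "(?F has_derivative (\<lambda>s. \<chi> j. s \<bullet> gradient (f j) x)) (at x)"
    using GDERIV_gradient[OF assms]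
    by (subst has_derivative_componentwise_within) (auto simp: gderiv_def Basis_vec_def inner_axis)
  moreover from this have "(?F has_derivative (\<lambda>s. jacobian ?F (at x) *v s)) (at x)"
    by (metis differentiableI jacobian_works)
  ultimately have "(\<lambda>s. jacobian ?F (at x) *v s) = (\<lambda>s. \<chi> j. s \<bullet> gradient (f j) x)"
    by (rule has_derivative_unique[rotated])
  from fun_cong[OF this, of s] show ?thesis
    by (simp add: inner_commute)
qed

lemma mat_norm_power2:
  assumes "sym_pos_def M"
  shows "(mat_norm M s)\<^sup>2 = s \<bullet> (M *v s)"
  using assms unfolding mat_norm_def sym_pos_def_def
  by (cases "s = 0") (auto simp: less_imp_le)

lemma loewner_ge_scaled_identityD:
  assumes "loewner_ge M (c *\<^sub>R mat 1)"
  shows "c * (norm s)\<^sup>2 \<le> s \<bullet> (M *v s)"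
proof -
  have "0 \<le> s \<bullet> ((M - c *\<^sub>R mat 1) *v s)"
    using assms by (simp add: loewner_ge_def sym_pos_semidef_def)
  also have "(M - c *\<^sub>R mat 1) *v s = M *v s - c *\<^sub>R s"
    by (simp add: matrix_vector_mult_diff_rdistrib flip: scaleR_matrix_vector_assoc)
  finally show ?thesis
    by (simp add: inner_diff_right power2_norm_eq_inner)
qed

section \<open>Real consequences of minimality\<close>

text \<open>After division by \<open>1 - t\<close> the hypothesis reads \<open>a \<le> - Q (1 + t)/2\<close>. It is
  the limit \<open>t \<rightarrow> 1\<close> that gives the factor 2 over the trivial bound
  \<open>a \<le> - Q/2\<close> obtained from \<open>t = 0\<close>.\<close>

lemma scaling_minimality_imp_le:
  fixes a Q :: real
  assumes "\<And>t. 0 \<le> t \<Longrightarrow> t < 1 \<Longrightarrow> a + Q / 2 \<le> t * a + Q / 2 * t\<^sup>2"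
  shows "a \<le> - Q"
proof (rule tendsto_le[OF trivial_limit_at_left_real])
  show "((\<lambda>t. - (Q / 2 * (1 + t))) \<longlongrightarrow> - Q) (at_left 1)"
    by (rule tendsto_eq_intros refl | simp)+
  show "((\<lambda>t. a) \<longlongrightarrow> a) (at_left (1::real))"
    by simp
  have "a \<le> - (Q / 2 * (1 + t))" if "0 \<le> t" "t < 1" for t
  proof -
    have "(1 - t) * - (Q / 2 * (1 + t)) = Q / 2 * t\<^sup>2 - Q / 2"
      by (simp add: field_simps power2_eq_square)
    then have "(1 - t) * a \<le> (1 - t) * - (Q / 2 * (1 + t))"
      using assms[OF that] by (simp add: left_diff_distrib)
    then show ?thesis
      using that by (simp only: mult_le_cancel_left_pos)
  qed
  then show "\<forall>\<^sub>F t in at_left 1. a \<le> - (Q / 2 * (1 + t))"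
    by (auto simp: eventually_at_left_field intro!: exI[of _ 0])
qed

text \<open>Here \<open>p\<close> stands for the optimal increment along a line with curvature \<open>q N\<close>, and
  \<open>r \<theta>\<close> for the increment of the unit step. By the bound on \<open>\<theta>\<close>, the right-hand side
  of the first hypothesis is at most \<open>\<theta> (r t - c2 t\<^sup>2 / (2 c3))\<close>. The factor of \<open>\<theta>\<close>
  is largest at \<open>t = r c3/c2\<close>; truncated to the unit interval, this \<open>t\<close> satisfies
  \<open>c2 t/c3 \<le> r\<close>, so at least half of the linear term survives.\<close>

lemma best_step_le:
  fixes p r \<theta> N q c2 c3 :: real
  assumes min: "\<And>t. 0 \<le> t \<Longrightarrow> t \<le> 1 \<Longrightarrow> p \<le> t * (r * \<theta>) + q / 2 * N * t\<^sup>2"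
    and \<theta>: "\<theta> \<le> - (c3 * N)" and "q \<le> c2" and "0 < c2" "0 < c3" "0 \<le> r" "0 \<le> N"
  shows "p \<le> r / 2 * min (r * c3 / c2) 1 * \<theta>"
proof -
  define t where "t = min (r * c3 / c2) 1"
  have t: "0 \<le> t" "t \<le> 1" "c2 * t \<le> r * c3"
    using assms(4-6) by (auto simp: t_def min_def field_simps)
  have "c3 * (q * N * t\<^sup>2) \<le> c3 * (c2 * N * t\<^sup>2)"
    using assms by (intro mult_left_mono mult_right_mono) auto
  also have "\<dots> = (c2 * t) * (c3 * N * t)"
    by (simp add: power2_eq_square)
  also have "\<dots> \<le> (r * c3) * (c3 * N * t)"
    using t assms by (intro mult_right_mono) auto
  also have "\<dots> = c3 * (r * t * (c3 * N))"
    by simp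
  also have "\<dots> \<le> c3 * (r * t * - \<theta>)"
    using t assms by (intro mult_left_mono) auto
  finally have "q * N * t\<^sup>2 \<le> r * t * - \<theta>"
    using \<open>0 < c3\<close> by (simp only: mult_le_cancel_left_pos)
  with min[OF t(1,2)] have "p \<le> r / 2 * t * \<theta>"
    by (simp add: algebra_simps)
  then show ?thesis
    by (simp only: t_def)
qed

section \<open>The model increments\<close>

lemma convex_fun_real_le:
  assumes "convex_fun h" "proper_fun h" "h a < \<infinity>" "h b < \<infinity>" "0 \<le> t" "t \<le> 1"
  shows "h ((1 - t) *\<^sub>R a + t *\<^sub>R b) < \<infinity>"
    and "real_of_ereal (h ((1 - t) *\<^sub>R a + t *\<^sub>R b))
           \<le> (1 - t) * real_of_ereal (h a) + t * real_of_ereal (h b)"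
proof -
  have fin: "h y \<noteq> - \<infinity>" for y
    using assms(2) by (simp add: proper_fun_def)
  obtain p r where pr: "h a = ereal p" "h b = ereal r"
    using assms(3,4) fin by (metis ereal_cases less_irrefl)
  have le: "h ((1 - t) *\<^sub>R a + t *\<^sub>R b) \<le> ereal ((1 - t) * p + t * r)"
    using assms(1,5,6) unfolding convex_fun_def by (metis pr atLeastAtMost_iff plus_ereal.simps(1) times_ereal.simps(1))
  then show "h ((1 - t) *\<^sub>R a + t *\<^sub>R b) < \<infinity>"
    by (auto simp: less_top[symmetric] top_ereal_def)
  then show "real_of_ereal (h ((1 - t) *\<^sub>R a + t *\<^sub>R b))
           \<le> (1 - t) * real_of_ereal (h a) + t * real_of_ereal (h b)"
    using le fin pr by (cases "h ((1 - t) *\<^sub>R a + t *\<^sub>R b)") auto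
qed

text \<open>On the effective domain all extended-real expressions are finite. The locale
  describes the point at which the subproblems are set up, and serves to pass once and for
  all to real-valued increments, restricted to the steps that stay in the domain.\<close>

locale composite_point =
  fixes f :: "'m::finite \<Rightarrow> real^'n \<Rightarrow> real"
    and g :: "'m \<Rightarrow> real^'p \<Rightarrow> ereal"
    and A :: "real^'n^'p"
    and xk :: "real^'n"
  assumes proper: "proper_fun (g i)"
    and convex: "convex_fun (g i)"
    and dom: "g i (A *v xk) < \<infinity>"
begin

definition feasible :: "real^'n \<Rightarrow> bool" where
  "feasible s \<longleftrightarrow> (\<forall>i. g i (A *v xk + A *v s) < \<infinity>)"

definition incr :: "'m \<Rightarrow> real^'n \<Rightarrow> real" where
  "incr i s = gradient (f i) xk \<bullet> s
     + real_of_ereal (g i (A *v xk + A *v s)) - real_of_ereal (g i (A *v xk))"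

definition wincr :: "real^'m \<Rightarrow> real^'n \<Rightarrow> real" where
  "wincr w s = (\<Sum>i\<in>UNIV. w $ i * incr i s)"

lemma g_finite: "g i y < \<infinity> \<Longrightarrow> ereal (real_of_ereal (g i y)) = g i y"
  using proper[of i] by (auto simp: proper_fun_def ereal_real)

lemma g_at: "g i (A *v xk) = ereal (real_of_ereal (g i (A *v xk)))"
  using g_finite[OF dom] by simp

lemma g_feasible: 
  "feasible s \<Longrightarrow> g i (A *v xk + A *v s) = ereal (real_of_ereal (g i (A *v xk + A *v s)))"
  using g_finite by (simp add: feasible_def)

lemma feasible_0: "feasible 0"
  using dom by (simp add: feasible_def)

lemma incr_0: "incr i 0 = 0"
  by (simp add: incr_def)

lemma
  assumes "feasible s" "feasible s'" "0 \<le> t" "t \<le> 1"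
  shows feasible_convex: "feasible ((1 - t) *\<^sub>R s + t *\<^sub>R s')"
    and incr_convex: "incr i ((1 - t) *\<^sub>R s + t *\<^sub>R s') \<le> (1 - t) * incr i s + t * incr i s'"
proof -
  have eq: "A *v xk + A *v ((1 - t) *\<^sub>R s + t *\<^sub>R s')
      = (1 - t) *\<^sub>R (A *v xk + A *v s) + t *\<^sub>R (A *v xk + A *v s')"
    by (simp add: matrix_vector_right_distrib matrix_vector_mult_scaleR algebra_simps)
  have fin: "g i (A *v xk + A *v s) < \<infinity>" "g i (A *v xk + A *v s') < \<infinity>" for i
    using assms(1,2) by (auto simp: feasible_def)
  note cv = convex_fun_real_le[OF convex proper fin assms(3,4), folded eq]
  show "feasible ((1 - t) *\<^sub>R s + t *\<^sub>R s')"
    using cv(1) by (simp add: feasible_def)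
  show "incr i ((1 - t) *\<^sub>R s + t *\<^sub>R s') \<le> (1 - t) * incr i s + t * incr i s'"
    using cv(2)[of i] unfolding incr_def by (simp add: inner_add_right algebra_simps)
qed

lemma
  assumes "feasible s" "0 \<le> t" "t \<le> 1"
  shows feasible_scale: "feasible (t *\<^sub>R s)"
    and incr_scale: "incr i (t *\<^sub>R s) \<le> t * incr i s"
  using feasible_convex[OF feasible_0 assms] incr_convex[OF feasible_0 assms, of i]
  by (simp_all add: incr_0)

lemma wincr_scale:
  assumes "feasible s" "0 \<le> t" "t \<le> 1" "\<And>i. 0 \<le> w $ i"
  shows "wincr w (t *\<^sub>R s) \<le> t * wincr w s"
  unfolding wincr_def sum_distrib_left
  by (rule sum_mono) (metis assms incr_scale mult.left_commute mult_left_mono)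

lemma scaling_minimizer_wincr_le:
  assumes "feasible s" "\<And>i. 0 \<le> w $ i"
    and "\<And>t. 0 \<le> t \<Longrightarrow> t \<le> 1 \<Longrightarrow> wincr w s + Q / 2 \<le> wincr w (t *\<^sub>R s) + Q / 2 * t\<^sup>2"
  shows "wincr w s \<le> - Q"
proof (rule scaling_minimality_imp_le)
  fix t :: real
  assume t: "0 \<le> t" "t < 1"
  then show "wincr w s + Q / 2 \<le> t * wincr w s + Q / 2 * t\<^sup>2"
    using assms(3)[of t] wincr_scale[OF assms(1) _ _ assms(2), of t] by simp
qed

text \<open>The facts from here on translate the extended-real subproblems and optimality
  conditions into statements about increments. The convention that a scalarised function is
  \<open>\<infinity>\<close> wherever some \<open>g i\<close> is, even one of weight zero, is what makes every
  minimizer feasible for all objectives.\<close>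

lemma gw_infeasible: "\<not> feasible s \<Longrightarrow> gw g w (A *v xk + A *v s) = \<infinity>"
  by (auto simp: gw_def winner_def feasible_def)

lemma gw_feasible:
  assumes "feasible s"
  shows "gw g w (A *v xk + A *v s)
    = ereal (\<Sum>i\<in>UNIV. w $ i * real_of_ereal (g i (A *v xk + A *v s)))"
proof -
  have "gw g w (A *v xk + A *v s) = (\<Sum>i\<in>UNIV. ereal (w $ i) * g i (A *v xk + A *v s))"
    using assms by (auto simp: gw_def winner_def feasible_def)
  also have "\<dots> = (\<Sum>i\<in>UNIV. ereal (w $ i * real_of_ereal (g i (A *v xk + A *v s))))"
    by (intro sum.cong refl) (subst g_feasible[OF assms], simp)
  finally show ?thesis
    by simp
qed

lemmas gw_at = gw_feasible[OF feasible_0, simplified]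

lemma gradw_inner: "gradw f w xk \<bullet> s = (\<Sum>i\<in>UNIV. w $ i * (gradient (f i) xk \<bullet> s))"
  by (simp add: gradw_def inner_sum_left)

lemma model_feasible:
  assumes "feasible s"
  shows "ereal (gradw f w xk \<bullet> s) + gw g w (A *v xk + A *v s) - gw g w (A *v xk)
    = ereal (wincr w s)"
  unfolding gw_feasible[OF assms] gw_at gradw_inner wincr_def incr_def
  by (simp add: sum.distrib sum_subtractf algebra_simps)

lemma pbb_objective_eq:
  "pbb_objective f g A P sc xk l (xk + s) =
     (if feasible s then ereal (wincr (cdiv l sc) s + (mat_norm P s)\<^sup>2 / 2) else \<infinity>)"
  using model_feasible[of s "cdiv l sc"] gw_infeasible[of s "cdiv l sc"]
  by (simp add: pbb_objective_def matrix_vector_right_distrib gw_at)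

text \<open>The line problem does not subtract the value of the scalarised \<open>g\<close> at the current
  point, hence the additive constant.\<close>

lemma line_objective_eq:
  assumes "\<And>i. f i differentiable (at xk)"
  shows "line_objective f g A al xk s q l z =
     (if feasible (z *\<^sub>R s)
      then ereal (wincr (cdiv l al) (z *\<^sub>R s)
             + (\<Sum>i\<in>UNIV. cdiv l al $ i * real_of_ereal (g i (A *v xk)))
             + q * (norm s)\<^sup>2 / 2 * z\<^sup>2)
      else \<infinity>)"
proof -
  let ?h = "\<lambda>i. ereal ((z *\<^sub>R (jacobian (\<lambda>x. \<chi> j. f j x) (at xk) *v s)) $ i)
            + g i (A *v xk + z *\<^sub>R (A *v s))"
  have h: "?h i = ereal (gradient (f i) xk \<bullet> (z *\<^sub>R s)) + g i (A *v xk + A *v (z *\<^sub>R s))" for i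
    by (simp add: jacobian_mult_component[OF assms] matrix_vector_mult_scaleR)
  show ?thesis
  proof (cases "feasible (z *\<^sub>R s)")
    case True
    have h': "?h i = ereal (incr i (z *\<^sub>R s) + real_of_ereal (g i (A *v xk)))" for i
      unfolding h by (subst g_feasible[OF True]) (simp add: incr_def)
    have "winner (cdiv l al) ?h = ereal (wincr (cdiv l al) (z *\<^sub>R s)
             + (\<Sum>i\<in>UNIV. cdiv l al $ i * real_of_ereal (g i (A *v xk))))"
      unfolding h' winner_def wincr_def by (simp add: sum.distrib algebra_simps)
    then show ?thesis
      using True by (simp add: line_objective_def)
  next
    case False
    then obtain i where "?h i = \<infinity>"
      unfolding h feasible_def by auto
    then have "winner (cdiv l al) ?h = \<infinity>"
      unfolding winner_def by auto
    then show ?thesis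
      using False by (simp add: line_objective_def)
  qed
qed

lemma pbb_minimizer:
  assumes "is_arg_min (pbb_objective f g A P sc xk l) (\<lambda>_. True) (xk + s)"
  shows "feasible s"
    and "feasible s' \<Longrightarrow> wincr (cdiv l sc) s + (mat_norm P s)\<^sup>2 / 2
                        \<le> wincr (cdiv l sc) s' + (mat_norm P s')\<^sup>2 / 2"
proof -
  have le: "pbb_objective f g A P sc xk l (xk + s) \<le> pbb_objective f g A P sc xk l (xk + s')" for s'
    using assms by (simp add: is_arg_min_linorder)
  show "feasible s"
    using le[of 0] feasible_0 by (simp only: pbb_objective_eq split: if_splits) auto
  then show "feasible s' \<Longrightarrow> wincr (cdiv l sc) s + (mat_norm P s)\<^sup>2 / 2
                        \<le> wincr (cdiv l sc) s' + (mat_norm P s')\<^sup>2 / 2"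
    using le[of s'] by (simp add: pbb_objective_eq)
qed

lemma line_minimizer:
  assumes "\<And>i. f i differentiable (at xk)"
    and "is_arg_min (line_objective f g A al xk s q l) (\<lambda>_. True) z"
  shows "feasible (z *\<^sub>R s)"
    and "feasible (z' *\<^sub>R s) \<Longrightarrow> wincr (cdiv l al) (z *\<^sub>R s) + q * (norm s)\<^sup>2 / 2 * z\<^sup>2
                        \<le> wincr (cdiv l al) (z' *\<^sub>R s) + q * (norm s)\<^sup>2 / 2 * z'\<^sup>2"
proof -
  have le: "line_objective f g A al xk s q l z \<le> line_objective f g A al xk s q l z'" for z'
    using assms(2) by (simp add: is_arg_min_linorder)
  show "feasible (z *\<^sub>R s)"
    using le[of 0] feasible_0 by (simp add: line_objective_eq[OF assms(1)] split: if_splits)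
  then show "feasible (z' *\<^sub>R s) \<Longrightarrow> wincr (cdiv l al) (z *\<^sub>R s) + q * (norm s)\<^sup>2 / 2 * z\<^sup>2
                        \<le> wincr (cdiv l al) (z' *\<^sub>R s) + q * (norm s)\<^sup>2 / 2 * z'\<^sup>2"
    using le[of z'] by (simp add: line_objective_eq[OF assms(1)])
qed

lemma pbb_minimizer_decrease:
  assumes min: "is_arg_min (pbb_objective f g A P sc xk l) (\<lambda>_. True) (xk + s)"
    and "\<And>i. 0 \<le> cdiv l sc $ i"
  shows "wincr (cdiv l sc) s \<le> - (mat_norm P s)\<^sup>2"
proof (rule scaling_minimizer_wincr_le[OF pbb_minimizer(1)[OF min] assms(2)])
  fix t :: real
  assume t: "0 \<le> t" "t \<le> 1"
  have "mat_norm P (t *\<^sub>R s) = t * mat_norm P s"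
    using t by (simp add: mat_norm_def matrix_vector_mult_scaleR real_sqrt_mult mult.assoc[symmetric])
  then show "wincr (cdiv l sc) s + (mat_norm P s)\<^sup>2 / 2
      \<le> wincr (cdiv l sc) (t *\<^sub>R s) + (mat_norm P s)\<^sup>2 / 2 * t\<^sup>2"
    using pbb_minimizer(2)[OF min feasible_scale[OF pbb_minimizer(1)[OF min] t]]
    by (simp add: power_mult_distrib mult.commute)
qed

lemma line_minimizer_decrease:
  assumes df: "\<And>i. f i differentiable (at xk)"
    and min: "is_arg_min (line_objective f g A al xk s q l) (\<lambda>_. True) z"
    and "\<And>i. 0 \<le> cdiv l al $ i"
  shows "wincr (cdiv l al) (z *\<^sub>R s) \<le> - (q * (norm (z *\<^sub>R s))\<^sup>2)"
proof (rule scaling_minimizer_wincr_le[OF line_minimizer(1)[OF df min] assms(3)])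
  fix t :: real
  assume t: "0 \<le> t" "t \<le> 1"
  show "wincr (cdiv l al) (z *\<^sub>R s) + q * (norm (z *\<^sub>R s))\<^sup>2 / 2
      \<le> wincr (cdiv l al) (t *\<^sub>R z *\<^sub>R s) + q * (norm (z *\<^sub>R s))\<^sup>2 / 2 * t\<^sup>2"
    using line_minimizer(2)[OF df min, of "t * z"] feasible_scale[OF line_minimizer(1)[OF df min] t]
    by (simp add: power_mult_distrib mult_ac)
qed

lemma D_PBB_leD:
  assumes "D_PBB f g A sc xk X l \<le> ereal M" and s: "X l = xk + s"
    and "feasible s" and "0 < sc $ i"
  shows "incr i s \<le> sc $ i * M"
proof -
  have "(ereal (gradient (f i) xk \<bullet> (X l - xk)) + g i (A *v X l) - g i (A *v xk)) / ereal (sc $ i)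
      \<le> D_PBB f g A sc xk X l"
    unfolding D_PBB_def by (rule Max_ge) auto
  also have "ereal (gradient (f i) xk \<bullet> (X l - xk)) + g i (A *v X l) - g i (A *v xk) = ereal (incr i s)"
    unfolding s matrix_vector_right_distrib
    by (subst g_feasible[OF \<open>feasible s\<close>], subst g_at) (simp add: incr_def)
  also note assms(1)
  finally have "incr i s / sc $ i \<le> M"
    using \<open>0 < sc $ i\<close> by simp
  then show ?thesis
    using \<open>0 < sc $ i\<close> by (simp add: field_simps)
qed

lemma D_sub_leD:
  assumes "D_sub f g A al xk v u z1 z2 l \<le> ereal M"
    and f1: "feasible (z1 l *\<^sub>R v)" and f2: "feasible (z2 l *\<^sub>R u)" and "0 < al $ i"
  shows "incr i (z1 l *\<^sub>R v) + incr i (z2 l *\<^sub>R u) \<le> al $ i * M"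
proof -
  let ?N = "ereal (gradient (f i) xk \<bullet> (z1 l *\<^sub>R v + z2 l *\<^sub>R u))
              + g i (A *v xk + z1 l *\<^sub>R (A *v v))
              + g i (A *v xk + z2 l *\<^sub>R (A *v u))
              - 2 * g i (A *v xk)"
  have "?N / ereal (al $ i) \<le> D_sub f g A al xk v u z1 z2 l"
    unfolding D_sub_def by (rule Max_ge) auto
  also have "?N = ereal (incr i (z1 l *\<^sub>R v) + incr i (z2 l *\<^sub>R u))"
    unfolding matrix_vector_mult_scaleR[symmetric]
    by (subst g_feasible[OF f1], subst g_feasible[OF f2], subst g_at)
      (simp add: incr_def inner_add_right)
  also note assms(1)
  finally have "(incr i (z1 l *\<^sub>R v) + incr i (z2 l *\<^sub>R u)) / al $ i \<le> M"
    using \<open>0 < al $ i\<close> by simp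
  then show ?thesis
    using \<open>0 < al $ i\<close> by (simp add: field_simps)
qed

lemma two_term_model:
  assumes f1: "feasible s" and f2: "feasible s'"
  shows "ereal (gradw f w xk \<bullet> (s + s')) + gw g w (A *v xk + A *v s)
           + gw g w (A *v xk + A *v s') - 2 * gw g w (A *v xk)
         = ereal (wincr w s + wincr w s')"
  unfolding gw_feasible[OF f1] gw_feasible[OF f2] gw_at gradw_inner wincr_def incr_def
  by (simp add: inner_add_right sum.distrib sum_subtractf algebra_simps)

end

section \<open>Descent along the subspace direction\<close>

theorem proposition5p2:
  fixes f :: "'m::finite \<Rightarrow> real^'n \<Rightarrow> real"
    and g :: "'m \<Rightarrow> real^'p \<Rightarrow> ereal"
    and A :: "real^'n^'p"
    and x :: "nat \<Rightarrow> real^'n" and x0 :: "real^'n"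
    and P B :: "nat \<Rightarrow> real^'n^'n"
    and \<alpha>t \<alpha> :: "nat \<Rightarrow> real^'m" and \<alpha>min \<alpha>max :: real
    and X :: "nat \<Rightarrow> real^'m \<Rightarrow> real^'n"
    and lPBB lS :: "nat \<Rightarrow> real^'m"
    and u v ut d :: "nat \<Rightarrow> real^'n"
    and q :: "nat \<Rightarrow> real^'n \<Rightarrow> real"
    and z1 z2 :: "nat \<Rightarrow> real^'m \<Rightarrow> real"
    and \<epsilon> \<delta> c1 c2 c3 :: real
    and k :: nat
  assumes f_C1: "\<And>i. continuously_differentiable (f i)"
    and g_proper: "\<And>i. proper_fun (g i)"
    and g_convex: "\<And>i. convex_fun (g i)"
    and g_lsc: "\<And>i. lsc_fun (g i)"
    and \<alpha>_bounds: "0 < \<alpha>min" "\<alpha>min \<le> \<alpha>max"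
    and v_def: "\<And>j. v j = X j (lPBB j) - x j"
    and ut_def: "\<And>j. ut j = B_orth (B j) (v j) (u j)"
    and d_def: "\<And>j. d j = z1 j (lS j) *\<^sub>R v j + z2 j (lS j) *\<^sub>R ut j"
    and x_dom: "A *v x k \<in> (\<Inter>i. edom (g i))"
    and P_spd: "sym_pos_def (P k)"
    and B_spd: "sym_pos_def (B k)"
    and \<alpha>t_box: "\<And>i. \<alpha>t k $ i \<in> {\<alpha>min..\<alpha>max}"
    and \<alpha>_box: "\<And>i. \<alpha> k $ i \<in> {\<alpha>min..\<alpha>max}"
    and lPBB_simplex: "lPBB k \<in> unit_simplex"
    and X_min: "is_arg_min (pbb_objective f g A (P k) (\<alpha>t k) (x k) (lPBB k)) (\<lambda>_. True) (X k (lPBB k))"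
    and v_nonzero: "v k \<noteq> 0"
    and PBB_approx:
      "D_PBB f g A (\<alpha>t k) (x k) (X k) (lPBB k)
         \<le> ereal (1 - \<epsilon>) *
             (ereal (gradw f (cdiv (lPBB k) (\<alpha>t k)) (x k) \<bullet> v k)
              + gw g (cdiv (lPBB k) (\<alpha>t k)) (A *v x k + A *v v k)
              - gw g (cdiv (lPBB k) (\<alpha>t k)) (A *v x k))"
    and u_proj: "is_projection (P k) (\<Inter>i. edom (\<lambda>y. g i (A *v y)))
                   (x k + (x k - prev x0 x k)) (x k + u k)"
    and q_pos: "0 < q k (v k)" "0 < q k (ut k)"
    and lS_simplex: "lS k \<in> unit_simplex"
    and z1_min: "is_arg_min (line_objective f g A (\<alpha> k) (x k) (v k) (q k (v k)) (lS k)) (\<lambda>_. True) (z1 k (lS k))"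
    and z2_min: "is_arg_min (line_objective f g A (\<alpha> k) (x k) (ut k) (q k (ut k)) (lS k)) (\<lambda>_. True) (z2 k (lS k))"
    and S_approx:
      "D_sub f g A (\<alpha> k) (x k) (v k) (ut k) (z1 k) (z2 k) (lS k)
         \<le> ereal (1 - \<delta>) *
             (ereal (gradw f (cdiv (lS k) (\<alpha> k)) (x k) \<bullet> d k)
              + gw g (cdiv (lS k) (\<alpha> k)) (A *v x k + z1 k (lS k) *\<^sub>R (A *v v k))
              + gw g (cdiv (lS k) (\<alpha> k)) (A *v x k + z2 k (lS k) *\<^sub>R (A *v ut k))
              - 2 * gw g (cdiv (lS k) (\<alpha> k)) (A *v x k))"
    and \<epsilon>\<delta>: "\<epsilon> \<in> {0..<1}" "\<delta> \<in> {0..<1}"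
    and c_pos: "0 < c1" "c1 \<le> c2" "0 < c3"
    and q_v_bounds: "\<And>j. c1 \<le> q j (v j) \<and> q j (v j) \<le> c2"
    and q_ut_bound: "\<And>j. c1 \<le> q j (ut j)"
    and P_bound: "\<And>j. loewner_ge (P j) (c3 *\<^sub>R mat 1)"
  shows "\<forall>i.
      ereal (gradient (f i) (x k) \<bullet> ((1/2) *\<^sub>R d k))
        + g i (A *v x k + (1/2) *\<^sub>R (A *v d k)) - g i (A *v x k)
        \<le> ereal (- (c1 * (1 - \<delta>) * \<alpha> k $ i / 4) * (norm (d k))\<^sup>2)
    \<and> ereal (gradient (f i) (x k) \<bullet> ((1/2) *\<^sub>R d k))
        + g i (A *v x k + (1/2) *\<^sub>R (A *v d k)) - g i (A *v x k)
        \<le> ereal ((1 - \<delta>) * (1 - \<epsilon>) * \<alpha>min / (4 * \<alpha>max)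
                   * min ((1 - \<epsilon>) * c3 * \<alpha>min / (c2 * \<alpha>max)) 1 * \<alpha> k $ i)
          * (ereal (gradw f (cdiv (lPBB k) (\<alpha>t k)) (x k) \<bullet> v k)
             + gw g (cdiv (lPBB k) (\<alpha>t k)) (A *v x k + A *v v k)
             - gw g (cdiv (lPBB k) (\<alpha>t k)) (A *v x k))"
proof -
  interpret cp: composite_point f g A "x k"
    by unfold_locales (use g_proper g_convex x_dom in \<open>auto simp: edom_def\<close>)
  define W where "W = cdiv (lPBB k) (\<alpha>t k)"
  define w where "w = cdiv (lS k) (\<alpha> k)"
  define r where "r = (1 - \<epsilon>) * \<alpha>min / \<alpha>max"
  define s1 where "s1 = z1 k (lS k) *\<^sub>R v k"
  define s2 where "s2 = z2 k (lS k) *\<^sub>R ut k"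
  define \<theta> where "\<theta> = cp.wincr W (v k)"
  have df: "f i differentiable (at (x k))" for i
    using f_C1 by (simp add: continuously_differentiable_def)
  have \<alpha>tk: "\<alpha>min \<le> \<alpha>t k $ i" and \<alpha>k: "\<alpha>min \<le> \<alpha> k $ i" "\<alpha> k $ i \<le> \<alpha>max" for i
    using \<alpha>t_box[of i] \<alpha>_box[of i] by auto
  have \<alpha>tk_pos: "0 < \<alpha>t k $ i" and \<alpha>k_pos: "0 < \<alpha> k $ i" for i
    using \<alpha>tk[of i] \<alpha>k[of i] \<alpha>_bounds by linarith+
  have lS: "0 \<le> lS k $ i" "(\<Sum>i\<in>UNIV. lS k $ i) = 1" for i
    using lS_simplex by (auto simp: unit_simplex_def)
  have W_nonneg: "0 \<le> W $ i" for i
    using lPBB_simplex \<alpha>tk_pos[of i] by (simp add: W_def cdiv_def unit_simplex_def)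
  have w_nonneg: "0 \<le> w $ i" for i
    using lS(1)[of i] \<alpha>k_pos[of i] by (simp add: w_def cdiv_def)
  have r_nonneg: "0 \<le> r"
    using \<epsilon>\<delta> \<alpha>_bounds by (simp add: r_def)
  have Xk: "X k (lPBB k) = x k + v k"
    by (simp add: v_def)
  note X_min' = X_min[unfolded Xk]
  have feas_v: "cp.feasible (v k)"
    by (rule cp.pbb_minimizer(1)[OF X_min'])
  have feas1: "cp.feasible s1"
    unfolding s1_def by (rule cp.line_minimizer(1)[OF df z1_min])
  have feas2: "cp.feasible s2"
    unfolding s2_def by (rule cp.line_minimizer(1)[OF df z2_min])
  have d: "d k = s1 + s2"
    by (simp add: d_def s1_def s2_def)

  have "\<theta> \<le> - (mat_norm (P k) (v k))\<^sup>2"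
    using cp.pbb_minimizer_decrease[OF X_min'] W_nonneg by (simp add: W_def \<theta>_def)
  then have \<theta>: "\<theta> \<le> - (c3 * (norm (v k))\<^sup>2)"
    using loewner_ge_scaled_identityD[OF P_bound, of "v k" k] mat_norm_power2[OF P_spd, of "v k"]
    by linarith
  then have "\<theta> \<le> 0"
    using c_pos by (smt (verit) mult_nonneg_nonneg zero_le_power2)

  have \<theta>_eq: "ereal (gradw f W (x k) \<bullet> v k) + gw g W (A *v x k + A *v v k) - gw g W (A *v x k)
      = ereal \<theta>"
    unfolding \<theta>_def by (rule cp.model_feasible[OF feas_v])
  \<comment> \<open>The bound must be the same for all objectives, so the scaling \<open>\<alpha>t k $ i\<close> is
    replaced by its lower bound; since \<open>\<theta> \<le> 0\<close>, this weakens the estimate.\<close>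
  have incr_v: "cp.incr i (v k) \<le> \<alpha>min * ((1 - \<epsilon>) * \<theta>)" for i
  proof -
    have "cp.incr i (v k) \<le> \<alpha>t k $ i * ((1 - \<epsilon>) * \<theta>)"
      using PBB_approx[folded W_def, unfolded \<theta>_eq]
      by (intro cp.D_PBB_leD[where X = "X k" and l = "lPBB k", OF _ Xk feas_v \<alpha>tk_pos]) simp
    also have "\<dots> \<le> \<alpha>min * ((1 - \<epsilon>) * \<theta>)"
      using \<alpha>tk[of i] \<open>\<theta> \<le> 0\<close> \<epsilon>\<delta>
      by (intro mult_right_mono_neg) (auto intro: mult_nonneg_nonpos)
    finally show ?thesis .
  qed
  \<comment> \<open>The weights \<open>w\<close> sum to at least \<open>1/\<alpha>max\<close>, not to 1; together
    with the factor \<open>\<alpha>min\<close> above this gives the ratio \<open>\<alpha>min/\<alpha>max\<close> in \<open>r\<close>.\<close>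
  have unit_step: "cp.wincr w (v k) \<le> r * \<theta>"
  proof -
    have "w $ i * cp.incr i (v k) \<le> lS k $ i * (r * \<theta>)" for i
    proof -
      have neg: "\<alpha>min * ((1 - \<epsilon>) * \<theta>) \<le> 0"
        using \<alpha>_bounds \<epsilon>\<delta> \<open>\<theta> \<le> 0\<close> by (auto intro!: mult_nonneg_nonpos)
      have "w $ i * cp.incr i (v k) \<le> w $ i * (\<alpha>min * ((1 - \<epsilon>) * \<theta>))"
        by (rule mult_left_mono[OF incr_v w_nonneg])
      also have "\<dots> \<le> lS k $ i / \<alpha>max * (\<alpha>min * ((1 - \<epsilon>) * \<theta>))"
        using lS(1)[of i] \<alpha>k[of i] \<alpha>k_pos[of i] neg
        by (intro mult_right_mono_neg) (auto simp: w_def cdiv_def intro: divide_left_mono)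
      finally show ?thesis
        by (simp add: r_def mult_ac)
    qed
    then have "cp.wincr w (v k) \<le> (\<Sum>i\<in>UNIV. lS k $ i * (r * \<theta>))"
      unfolding cp.wincr_def by (rule sum_mono)
    then show ?thesis
      by (simp add: lS(2) flip: sum_distrib_right)
  qed
  have p1: "cp.wincr w s1 \<le> r / 2 * min (r * c3 / c2) 1 * \<theta>"
  proof (rule best_step_le[OF _ \<theta>])
    fix t :: real
    assume t: "0 \<le> t" "t \<le> 1"
    have "0 \<le> q k (v k) * (norm (v k))\<^sup>2 / 2 * (z1 k (lS k))\<^sup>2"
      using q_pos by simp
    moreover have "cp.wincr w s1 + q k (v k) * (norm (v k))\<^sup>2 / 2 * (z1 k (lS k))\<^sup>2
        \<le> cp.wincr w (t *\<^sub>R v k) + q k (v k) * (norm (v k))\<^sup>2 / 2 * t\<^sup>2"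
      unfolding w_def s1_def
      by (rule cp.line_minimizer(2)[OF df z1_min cp.feasible_scale[OF feas_v t]])
    moreover have "cp.wincr w (t *\<^sub>R v k) \<le> t * cp.wincr w (v k)"
      by (rule cp.wincr_scale[OF feas_v t w_nonneg])
    moreover have "t * cp.wincr w (v k) \<le> t * (r * \<theta>)"
      by (rule mult_left_mono[OF unit_step t(1)])
    ultimately show "cp.wincr w s1 \<le> t * (r * \<theta>) + q k (v k) / 2 * (norm (v k))\<^sup>2 * t\<^sup>2"
      by simp
  qed (use q_v_bounds c_pos r_nonneg in auto)

  have curv: "cp.wincr w s1 \<le> - (c1 * (norm s1)\<^sup>2)" "cp.wincr w s2 \<le> - (c1 * (norm s2)\<^sup>2)"
  proof -
    have "cp.wincr w s1 \<le> - (q k (v k) * (norm s1)\<^sup>2)"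
      using cp.line_minimizer_decrease[OF df z1_min] w_nonneg by (simp add: w_def s1_def)
    moreover have "c1 * (norm s1)\<^sup>2 \<le> q k (v k) * (norm s1)\<^sup>2"
      using q_v_bounds by (simp add: mult_right_mono)
    ultimately show "cp.wincr w s1 \<le> - (c1 * (norm s1)\<^sup>2)"
      by linarith
    have "cp.wincr w s2 \<le> - (q k (ut k) * (norm s2)\<^sup>2)"
      using cp.line_minimizer_decrease[OF df z2_min] w_nonneg by (simp add: w_def s2_def)
    moreover have "c1 * (norm s2)\<^sup>2 \<le> q k (ut k) * (norm s2)\<^sup>2"
      using q_ut_bound by (simp add: mult_right_mono)
    ultimately show "cp.wincr w s2 \<le> - (c1 * (norm s2)\<^sup>2)"
      by linarith
  qed
  have "cp.wincr w s2 \<le> 0"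
    using curv(2) c_pos by (smt (verit) mult_nonneg_nonneg zero_le_power2)
  have "(norm (s1 + s2))\<^sup>2 + (norm (s1 - s2))\<^sup>2 = 2 * (norm s1)\<^sup>2 + 2 * (norm s2)\<^sup>2"
    by (simp add: power2_norm_eq_inner inner_simps inner_commute)
  then have "(norm (d k))\<^sup>2 \<le> 2 * ((norm s1)\<^sup>2 + (norm s2)\<^sup>2)"
    unfolding d by (smt (verit) zero_le_power2)
  then have "c1 * (norm (d k))\<^sup>2 \<le> c1 * (2 * ((norm s1)\<^sup>2 + (norm s2)\<^sup>2))"
    using c_pos by (intro mult_left_mono) auto
  with curv have sum_curv: "cp.wincr w s1 + cp.wincr w s2 \<le> - (c1 / 2 * (norm (d k))\<^sup>2)"
    by (simp add: algebra_simps)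

  have half: "(1/2) *\<^sub>R d k = (1 - 1/2) *\<^sub>R s1 + (1/2) *\<^sub>R s2"
    by (simp add: d scaleR_add_right)
  have feas_half: "cp.feasible ((1/2) *\<^sub>R d k)"
    unfolding half by (rule cp.feasible_convex[OF feas1 feas2]) auto
  have LHS: "ereal (gradient (f i) (x k) \<bullet> ((1/2) *\<^sub>R d k))
        + g i (A *v x k + (1/2) *\<^sub>R (A *v d k)) - g i (A *v x k)
      = ereal (cp.incr i ((1/2) *\<^sub>R d k))" for i
    unfolding matrix_vector_mult_scaleR[symmetric]
    by (subst cp.g_feasible[OF feas_half], subst cp.g_at) (simp add: cp.incr_def)
  have main: "cp.incr i ((1/2) *\<^sub>R d k)
      \<le> (1 - \<delta>) * \<alpha> k $ i / 2 * (cp.wincr w s1 + cp.wincr w s2)" for i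
  proof -
    have "cp.incr i ((1/2) *\<^sub>R d k) \<le> (1 - 1/2) * cp.incr i s1 + 1/2 * cp.incr i s2"
      unfolding half by (rule cp.incr_convex[OF feas1 feas2]) auto
    moreover have "cp.incr i s1 + cp.incr i s2
        \<le> \<alpha> k $ i * ((1 - \<delta>) * (cp.wincr w s1 + cp.wincr w s2))"
      using S_approx[folded w_def] cp.two_term_model[OF feas1 feas2, of w] feas1 feas2
      unfolding s1_def s2_def d_def matrix_vector_mult_scaleR
      by (intro cp.D_sub_leD[OF _ _ _ \<alpha>k_pos]) simp_all
    ultimately show ?thesis
      by (simp add: field_simps)
  qed
  have wt: "0 \<le> (1 - \<delta>) * \<alpha> k $ i / 2" for i
    using \<epsilon>\<delta> \<alpha>k_pos[of i] by simp
  have first: "cp.incr i ((1/2) *\<^sub>R d k) \<le> - (c1 * (1 - \<delta>) * \<alpha> k $ i / 4) * (norm (d k))\<^sup>2" for i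
    using main[of i] mult_left_mono[OF sum_curv wt[of i]] by (simp add: algebra_simps)
  have second: "cp.incr i ((1/2) *\<^sub>R d k)
      \<le> (1 - \<delta>) * (1 - \<epsilon>) * \<alpha>min / (4 * \<alpha>max)
          * min ((1 - \<epsilon>) * c3 * \<alpha>min / (c2 * \<alpha>max)) 1 * \<alpha> k $ i * \<theta>" for i
  proof -
    have "cp.wincr w s1 + cp.wincr w s2 \<le> r / 2 * min (r * c3 / c2) 1 * \<theta>"
      using p1 \<open>cp.wincr w s2 \<le> 0\<close> by linarith
    from mult_left_mono[OF this wt[of i]] main[of i]
    have "cp.incr i ((1/2) *\<^sub>R d k)
        \<le> (1 - \<delta>) * \<alpha> k $ i / 2 * (r / 2 * min (r * c3 / c2) 1 * \<theta>)"
      by linarith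
    also have "r * c3 / c2 = (1 - \<epsilon>) * c3 * \<alpha>min / (c2 * \<alpha>max)"
      by (simp add: r_def mult_ac)
    finally show ?thesis
      by (simp add: r_def mult_ac)
  qed
  show ?thesis
    unfolding LHS W_def[symmetric] \<theta>_eq using first second by simp
qed

end
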